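(* Let $(X,d)$ be a complete $CAT(0)$ space, let $K\subset X$ be nonempty, closed, convex and bounded, and let $T:K\to K$ be nonexpansive. Let $(\lambda_n)_{n\ge 1}\subset(0,1)$, let $x_0\in K$, and let $(x_n)_{n\ge 0}$ be the Krasnosel'skii–Mann iteration $$x_{n+1}=(1-\lambda_{n+1})x_n\oplus\lambda_{n+1}Tx_n,\qquad n\ge 0.$$ Then for all $n\ge 1$, $$d(x_n,Tx_n)\le \frac{\mathrm{diam}(K)}{\sqrt{\pi\sum_{i=1}^{n}\lambda_i(1-\lambda_i)}}.$$
   Context: A geodesic space $(X,d)$ is a metric space in which any two points $x,y$ are joined by a geodesic (an isometric image of the interval $[0,d(x,y)]$). It is a $CAT(0)$ space if for every geodesic triangle $\Delta$ in $X$ and all points $p,q\in\Delta$, $d(p,q)\le\|\bar p-\bar q\|$, where $\bar p,\bar q$ are the corresponding points of a comparison triangle (a triangle with the same side lengths) in the Euclidean plane. Every $CAT(0)$ space is uniquely geodesic. For $x,y\in X$ and $t\in[0,1]$, $(1-t)x\oplus ty$ denotes the unique point $z$ of the geodesic segment $[x,y]$ with $d(z,x)=t\,d(x,y)$ and $d(z,y)=(1-t)\,d(x,y)$. A set $K\subset X$ is convex if $[x,y]\subset K$ for all $x,y\in K$. A map $T:K\to K$ is nonexpansive if $d(Tx,Ty)\le d(x,y)$ for all $x,y\in K$. $\mathrm{diam}(K)=\sup_{x,y\in K}d(x,y)$. In the bound, $\pi$ is the usual constant $3.14159\ldots$ *)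

theory Defs
  imports "HOL-Analysis.Analysis"
begin

text \<open>Throughout, the metric space is a subset \<open>X\<close> of a type of class \<open>metric_space\<close>, equipped with
  the induced metric; geodesics and geodesic segments are required to stay inside \<open>X\<close>.\<close>

definition geodesic_in :: "'a::metric_space set \<Rightarrow> 'a \<Rightarrow> 'a \<Rightarrow> (real \<Rightarrow> 'a) \<Rightarrow> bool" where
  "geodesic_in X x y c \<longleftrightarrow>
     c ` {0..dist x y} \<subseteq> X \<and> c 0 = x \<and> c (dist x y) = y \<and>
     (\<forall>s\<in>{0..dist x y}. \<forall>t\<in>{0..dist x y}. dist (c s) (c t) = \<bar>s - t\<bar>)"

definition geodesic_segment :: "'a::metric_space set \<Rightarrow> 'a \<Rightarrow> 'a \<Rightarrow> 'a set \<Rightarrow> bool" where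
  "geodesic_segment X x y S \<longleftrightarrow> (\<exists>c. geodesic_in X x y c \<and> S = c ` {0..dist x y})"

definition geodesic_space :: "'a::metric_space set \<Rightarrow> bool" where
  "geodesic_space X \<longleftrightarrow> (\<forall>x\<in>X. \<forall>y\<in>X. \<exists>c. geodesic_in X x y c)"

definition geodesic_triangle ::
  "'a::metric_space set \<Rightarrow> 'a \<Rightarrow> 'a \<Rightarrow> 'a \<Rightarrow> 'a set \<Rightarrow> 'a set \<Rightarrow> 'a set \<Rightarrow> bool" where
  "geodesic_triangle X u v w A B C \<longleftrightarrow>
     geodesic_segment X u v A \<and> geodesic_segment X v w B \<and> geodesic_segment X w u C"

definition comparison_triangle ::
  "'a::metric_space \<Rightarrow> 'a \<Rightarrow> 'a \<Rightarrow> real^2 \<Rightarrow> real^2 \<Rightarrow> real^2 \<Rightarrow> bool" where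
  "comparison_triangle u v w u' v' w' \<longleftrightarrow>
     dist u' v' = dist u v \<and> dist v' w' = dist v w \<and> dist w' u' = dist w u"

text \<open>\<open>p'\<close> corresponds to the point \<open>p\<close> of the side \<open>S\<close> that starts at \<open>a\<close>; the side of the comparison
  triangle matching \<open>S\<close> joins \<open>a'\<close> to \<open>b'\<close>.\<close>

definition comparison_on_side ::
  "'a::metric_space set \<Rightarrow> 'a \<Rightarrow> real^2 \<Rightarrow> real^2 \<Rightarrow> 'a \<Rightarrow> real^2 \<Rightarrow> bool" where
  "comparison_on_side S a a' b' p p' \<longleftrightarrow>
     p \<in> S \<and> p' \<in> closed_segment a' b' \<and> dist a' p' = dist a p"

text \<open>A point lying on several sides has a comparison point for each of them.\<close>

definition comparison_point ::
  "'a::metric_space \<Rightarrow> 'a \<Rightarrow> 'a \<Rightarrow> 'a set \<Rightarrow> 'a set \<Rightarrow> 'a set \<Rightarrow>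
   real^2 \<Rightarrow> real^2 \<Rightarrow> real^2 \<Rightarrow> 'a \<Rightarrow> real^2 \<Rightarrow> bool" where
  "comparison_point u v w A B C u' v' w' p p' \<longleftrightarrow>
     comparison_on_side A u u' v' p p' \<or>
     comparison_on_side B v v' w' p p' \<or>
     comparison_on_side C w w' u' p p'"

text \<open>Comparison triangles exist by the triangle inequality and are unique up to isometry, so it does
  not matter that all of them are quantified over.\<close>

definition CAT0_space :: "'a::metric_space set \<Rightarrow> bool" where
  "CAT0_space X \<longleftrightarrow> geodesic_space X \<and>
     (\<forall>u v w A B C u' v' w'.
        geodesic_triangle X u v w A B C \<longrightarrow> comparison_triangle u v w u' v' w' \<longrightarrow>
        (\<forall>p q p' q'.
           comparison_point u v w A B C u' v' w' p p' \<longrightarrow>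
           comparison_point u v w A B C u' v' w' q q' \<longrightarrow>
           dist p q \<le> dist p' q'))"

definition geodesic_convex :: "'a::metric_space set \<Rightarrow> 'a set \<Rightarrow> bool" where
  "geodesic_convex X K \<longleftrightarrow>
     K \<subseteq> X \<and> (\<forall>x\<in>K. \<forall>y\<in>K. \<forall>S. geodesic_segment X x y S \<longrightarrow> S \<subseteq> K)"

text \<open>\<open>geodesic_comb X t x y\<close> is the point written $(1-t)x \oplus ty$.\<close>

definition geodesic_comb :: "'a::metric_space set \<Rightarrow> real \<Rightarrow> 'a \<Rightarrow> 'a \<Rightarrow> 'a" where
  "geodesic_comb X t x y =
     (THE z. (\<exists>S. geodesic_segment X x y S \<and> z \<in> S) \<and>
             dist z x = t * dist x y \<and> dist z y = (1 - t) * dist x y)"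

text \<open>In a CAT(0) space the definite description above is well defined.\<close>

lemma geodesic_in_rev:
  assumes "geodesic_in X x y c"
  shows "geodesic_in X y x (\<lambda>t. c (dist x y - t))"
  using assms unfolding geodesic_in_def by (auto simp: dist_commute image_subset_iff)

lemma geodesic_segment_sym:
  assumes "geodesic_segment X x y S"
  shows "geodesic_segment X y x S"
proof -
  obtain c where c: "geodesic_in X x y c" "S = c ` {0..dist x y}"
    using assms unfolding geodesic_segment_def by blast
  have "S = (\<lambda>t. c (dist x y - t)) ` {0..dist y x}"
  proof -
    have "(\<lambda>t. dist x y - t) ` {0..dist x y} = {0..dist x y}"
      by (simp add: image_diff_atLeastAtMost)
    then show ?thesis
      unfolding c(2) by (metis dist_commute image_image)
  qed
  then show ?thesis
    unfolding geodesic_segment_def using geodesic_in_rev[OF c(1)] by blast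
qed

lemma geodesic_comb_unique:
  assumes X: "CAT0_space X" "x \<in> X" "y \<in> X" and t: "0 \<le> t" "t \<le> 1"
  shows "\<exists>!z. (\<exists>S. geodesic_segment X x y S \<and> z \<in> S) \<and>
             dist z x = t * dist x y \<and> dist z y = (1 - t) * dist x y"
proof -
  obtain c where c: "geodesic_in X x y c"
    using X unfolding CAT0_space_def geodesic_space_def by blast
  define d where "d = dist x y"
  have td: "0 \<le> t * d" "t * d \<le> d"
    using t by (auto simp: d_def mult_left_le_one_le)
  have c': "c 0 = x" "c d = y"
    "\<And>r s. 0 \<le> r \<Longrightarrow> r \<le> d \<Longrightarrow> 0 \<le> s \<Longrightarrow> s \<le> d \<Longrightarrow> dist (c r) (c s) = \<bar>r - s\<bar>"
    using c unfolding geodesic_in_def d_def by auto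
  have "dist (c (t * d)) (c 0) = t * d" "dist (c (t * d)) (c d) = (1 - t) * d"
    using td by (auto simp: c'(3) algebra_simps)
  moreover have "\<exists>S. geodesic_segment X x y S \<and> c (t * d) \<in> S"
    using c td unfolding geodesic_segment_def d_def by force
  ultimately have ex: "(\<exists>S. geodesic_segment X x y S \<and> c (t * d) \<in> S) \<and>
      dist (c (t * d)) x = t * dist x y \<and> dist (c (t * d)) y = (1 - t) * dist x y"
    using c'(1,2) by (simp flip: d_def)
  have uniq: "p = q"
    if p: "geodesic_segment X x y S" "p \<in> S" "dist p x = t * d" "dist p y = (1 - t) * d"
      and q: "geodesic_segment X x y S'" "q \<in> S'" "dist q x = t * d" "dist q y = (1 - t) * d"
    for p q S S'
  proof -
    define x' y' p' :: "real^2" where "x' = 0" and "y' = d *\<^sub>R axis 1 1" and "p' = (t * d) *\<^sub>R axis 1 1"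
    have d0: "0 \<le> d" by (simp add: d_def)
    have "geodesic_segment X y y {y}"
      unfolding geodesic_segment_def geodesic_in_def using X by (intro exI[of _ "\<lambda>_. y"]) auto
    then have tri: "geodesic_triangle X x y y S {y} S'"
      using p(1) geodesic_segment_sym[OF q(1)] unfolding geodesic_triangle_def by blast
    have cmp: "comparison_triangle x y y x' y' y'"
      using d0 by (simp add: comparison_triangle_def x'_def y'_def dist_norm d_def[symmetric] dist_commute)
    have "p' = (1 - t) *\<^sub>R x' + t *\<^sub>R y'"
      by (simp add: x'_def y'_def p'_def)
    then have seg: "p' \<in> closed_segment x' y'"
      unfolding closed_segment_def using t by blast
    have dx: "dist x' p' = t * d"
      using td by (simp add: x'_def p'_def dist_norm)
    have "y' - p' = ((1 - t) * d) *\<^sub>R axis 1 1"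
      by (simp add: y'_def p'_def algebra_simps)
    then have dy: "dist y' p' = (1 - t) * d"
      using t d0 by (simp add: dist_norm)
    have "comparison_point x y y S {y} S' x' y' y' p p'"
      using p seg dx unfolding comparison_point_def comparison_on_side_def by (simp add: dist_commute)
    moreover have "comparison_point x y y S {y} S' x' y' y' q p'"
      using q seg dy unfolding comparison_point_def comparison_on_side_def
      by (simp add: dist_commute closed_segment_commute)
    ultimately have "dist p q \<le> dist p' p'"
      using X(1) tri cmp unfolding CAT0_space_def by blast
    then show "p = q" by simp
  qed
  show ?thesis
  proof (rule ex1I[where a = "c (t * d)"], rule ex)
    fix z
    assume "(\<exists>S. geodesic_segment X x y S \<and> z \<in> S) \<and>
      dist z x = t * dist x y \<and> dist z y = (1 - t) * dist x y"
    with ex show "z = c (t * d)"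
      using uniq by (metis d_def)
  qed
qed

end

theory Submission
  imports Defs "HOL-Probability.Distributions"
begin

text \<open>Convexity of \<open>d(p, \<cdot>)\<close> along geodesics yields recursive bounds for \<open>d(x\<^sub>m, x\<^sub>n)\<close> and
  \<open>d(x\<^sub>m, T x\<^sub>n)\<close> in units of the diameter. The recursion is solved exactly by survival
  probabilities: a lazy symmetric walk, which at time \<open>i\<close> moves by \<open>\<plusminus>1\<close> with probability
  \<open>\<lambda>\<^sub>i (1 - \<lambda>\<^sub>i)\<close> each, has to avoid \<open>0\<close>. By the reflection principle and Fourier inversion the
  survival probability for the start in \<open>1\<close> is
  \<open>1/\<pi> \<integral>\<^sub>0\<^sup>\<pi> (\<Prod>\<^sub>i 1 - 2 \<lambda>\<^sub>i (1 - \<lambda>\<^sub>i) (1 - cos \<theta>)) (1 + cos \<theta>) d\<theta>\<close>. Bounding each factor by an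
  exponential and substituting \<open>w = sin (\<theta>/2)\<close> leaves a Gaussian integral, which gives the
  constant \<open>\<pi>\<close>.\<close>

section \<open>Convexity of the metric in CAT(0) spaces\<close>

lemma comparison_triangle_exists:
  fixes u v w :: "'a::metric_space"
  shows "\<exists>u' v' w'. comparison_triangle u v w u' v' w'"
proof -
  define a b c where "a = dist v w" and "b = dist w u" and "c = dist u v"
  have abc: "a \<le> b + c" "b \<le> a + c" "c \<le> a + b" "a \<ge> 0" "b \<ge> 0" "c \<ge> 0"
    using dist_triangle[of v w u] dist_triangle[of w u v] dist_triangle[of u v w]
    by (simp_all add: a_def b_def c_def dist_commute add.commute)
  have dist2: "dist p q = sqrt ((p $ 1 - q $ 1)\<^sup>2 + (p $ 2 - q $ 2)\<^sup>2)" for p q :: "real^2"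
    by (simp add: dist_vec_def L2_set_def sum_2 dist_real_def)
  show ?thesis
  proof (cases "c = 0")
    case True
    then have "a = b" using abc by linarith
    then show ?thesis
      using True abc
      by (intro exI[of _ "0::real^2"] exI[of _ "vector [a, 0] :: real^2"])
        (simp add: comparison_triangle_def dist2 flip: a_def b_def c_def)
  next
    case False
    then have c: "c > 0" using abc by linarith
    \<comment> \<open>By the law of cosines, \<open>s\<close> is the first coordinate of
      \<open>w'\<close> when \<open>u'\<close> is the origin and \<open>v'\<close> lies on the first
      axis. The triangle inequality gives \<open>\<bar>s\<bar> \<le> b\<close>, so the second
      coordinate is real.\<close>
    define s where "s = (b\<^sup>2 + c\<^sup>2 - a\<^sup>2) / (2 * c)"
    have sc: "2 * c * s = b\<^sup>2 + c\<^sup>2 - a\<^sup>2" using c by (simp add: s_def)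
    have "(b + c)\<^sup>2 \<ge> a\<^sup>2" "(b - c)\<^sup>2 \<le> a\<^sup>2"
      using abc by (auto intro!: power_mono abs_le_square_iff[THEN iffD1])
    then have "2 * c * s \<le> 2 * c * b" "2 * c * (- s) \<le> 2 * c * b"
      using sc by (auto simp: power2_eq_square algebra_simps)
    then have "s \<le> b" "- s \<le> b" using c by (simp_all only: mult_le_cancel_left_pos mult_pos_pos zero_less_numeral)
    then have "\<bar>s\<bar> \<le> \<bar>b\<bar>" by linarith
    then have "s\<^sup>2 \<le> b\<^sup>2" by (simp only: abs_le_square_iff)
    then have t: "(sqrt (b\<^sup>2 - s\<^sup>2))\<^sup>2 = b\<^sup>2 - s\<^sup>2" by simp
    have "(c - s)\<^sup>2 + (b\<^sup>2 - s\<^sup>2) = a\<^sup>2"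
      using sc by (simp add: power2_eq_square algebra_simps)
    with t show ?thesis
      using abc
      by (intro exI[of _ "0::real^2"] exI[of _ "vector [c, 0] :: real^2"]
          exI[of _ "vector [s, sqrt (b\<^sup>2 - s\<^sup>2)] :: real^2"])
        (simp add: comparison_triangle_def dist2 flip: a_def b_def c_def)
  qed
qed

lemma geodesic_comb_on_segment:
  assumes "CAT0_space X" "x \<in> X" "y \<in> X" "0 \<le> t" "t \<le> 1"
  obtains S where "geodesic_segment X x y S" "geodesic_comb X t x y \<in> S"
    "dist (geodesic_comb X t x y) x = t * dist x y"
proof -
  have "(\<exists>S. geodesic_segment X x y S \<and> geodesic_comb X t x y \<in> S) \<and>
      dist (geodesic_comb X t x y) x = t * dist x y \<and>
      dist (geodesic_comb X t x y) y = (1 - t) * dist x y"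
    unfolding geodesic_comb_def by (rule theI'[OF geodesic_comb_unique[OF assms]])
  then show ?thesis using that by blast
qed

lemma geodesic_comb_in_convex:
  assumes "CAT0_space X" "geodesic_convex X K" "x \<in> K" "y \<in> K" "0 \<le> t" "t \<le> 1"
  shows "geodesic_comb X t x y \<in> K"
proof -
  have "x \<in> X" "y \<in> X" using assms(2-4) by (auto simp: geodesic_convex_def)
  then obtain S where "geodesic_segment X x y S" "geodesic_comb X t x y \<in> S"
    using geodesic_comb_on_segment[OF assms(1) _ _ assms(5,6)] by metis
  then show ?thesis
    using assms(2-4) unfolding geodesic_convex_def by blast
qed

text \<open>In the comparison triangle this is convexity of the Euclidean norm. The CAT(0)
  inequality carries it back, since \<open>p\<close> is a vertex and the combination lies on the
  opposite side.\<close>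

lemma CAT0_dist_geodesic_comb_le:
  assumes X: "CAT0_space X" "p \<in> X" "x \<in> X" "y \<in> X" and t: "0 \<le> t" "t \<le> 1"
  shows "dist p (geodesic_comb X t x y) \<le> (1 - t) * dist p x + t * dist p y"
proof -
  define z where "z = geodesic_comb X t x y"
  obtain B where B: "geodesic_segment X x y B" "z \<in> B" "dist z x = t * dist x y"
    using geodesic_comb_on_segment[OF X(1,3,4) t] unfolding z_def by blast
  obtain A where A: "geodesic_segment X p x A"
    using X unfolding CAT0_space_def geodesic_space_def geodesic_segment_def by blast
  obtain C where C: "geodesic_segment X y p C"
    using X unfolding CAT0_space_def geodesic_space_def geodesic_segment_def by blast
  have pA: "p \<in> A"
    using A unfolding geodesic_segment_def geodesic_in_def by force
  obtain p' x' y' where cmp: "comparison_triangle p x y p' x' y'"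
    using comparison_triangle_exists by blast
  then have d: "dist p' x' = dist p x" "dist x' y' = dist x y" "dist p' y' = dist p y"
    by (auto simp: comparison_triangle_def dist_commute)
  define z' where "z' = (1 - t) *\<^sub>R x' + t *\<^sub>R y'"
  have "x' - z' = t *\<^sub>R (x' - y')" by (simp add: z'_def algebra_simps)
  then have "dist x' z' = dist x z"
    using B(3) t d(2) by (simp add: dist_norm[of x'] dist_commute[of x])
  moreover have "z' \<in> closed_segment x' y'"
    using t unfolding z'_def closed_segment_def by blast
  ultimately have "comparison_point p x y A B C p' x' y' z z'"
    using B(2) unfolding comparison_point_def comparison_on_side_def by blast
  moreover have "comparison_point p x y A B C p' x' y' p p'"
    using pA unfolding comparison_point_def comparison_on_side_def by simp
  moreover have "geodesic_triangle X p x y A B C"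
    using A B C by (simp add: geodesic_triangle_def)
  ultimately have "dist p z \<le> dist p' z'"
    using X(1) cmp unfolding CAT0_space_def by blast
  also have "p' - z' = (1 - t) *\<^sub>R (p' - x') + t *\<^sub>R (p' - y')"
    by (simp add: z'_def algebra_simps)
  then have "dist p' z' \<le> (1 - t) * dist p' x' + t * dist p' y'"
    using norm_triangle_ineq[of "(1 - t) *\<^sub>R (p' - x')" "t *\<^sub>R (p' - y')"] t by (simp add: dist_norm)
  finally show ?thesis by (simp add: d z_def)
qed

section \<open>Survival probabilities of a lazy random walk\<close>

text \<open>The characteristic function of the displacement after \<open>m\<close> steps: a step
  contributes \<open>1 - 2 * p + 2 * p * cos \<theta>\<close> with
  \<open>p = lam i * (1 - lam i)\<close>.\<close>

definition lazy_walk_char :: "(nat \<Rightarrow> real) \<Rightarrow> nat \<Rightarrow> real \<Rightarrow> real" where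
  "lazy_walk_char lam m \<theta> = (\<Prod>i=1..m. 1 - 2 * (lam i * (1 - lam i)) * (1 - cos \<theta>))"

text \<open>This equals \<open>\<Sum>j=1-s..s. cos (j * \<theta>)\<close>: by reflection, the walk from \<open>s\<close> avoids \<open>0\<close> with
  the probability that the displacement of the free walk lies in \<open>{1-s..s}\<close>.\<close>

definition reflection_kernel :: "nat \<Rightarrow> real \<Rightarrow> real" where
  "reflection_kernel s \<theta> = (\<Sum>j<s. cos (real j * \<theta>) + cos (real (Suc j) * \<theta>))"

text \<open>Fourier inversion: as the characteristic function is real and even, displacement
  \<open>j\<close> has as its probability the mean over \<open>{0..pi}\<close> of that function
  times \<open>cos (j * \<theta>)\<close>.\<close>

definition survival :: "(nat \<Rightarrow> real) \<Rightarrow> nat \<Rightarrow> nat \<Rightarrow> real" where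
  "survival lam m s = integral {0..pi} (\<lambda>\<theta>. lazy_walk_char lam m \<theta> * reflection_kernel s \<theta>) / pi"

text \<open>The sum inherits the recurrence of its cosines. Multiplication by
  \<open>2 * cos \<theta>\<close> thus adds up the two neighbours of a start, as a step of the walk
  does.\<close>

lemma reflection_kernel_rec:
  "reflection_kernel (Suc (Suc s)) \<theta> + reflection_kernel s \<theta> =
     2 * cos \<theta> * reflection_kernel (Suc s) \<theta>"
proof (induction s)
  case 0
  have "cos (2 * \<theta>) = 2 * (cos \<theta>)\<^sup>2 - 1" by (rule cos_double_cos)
  then show ?case
    by (simp add: reflection_kernel_def power2_eq_square algebra_simps)
next
  case (Suc s)
  have shift: "cos (real (Suc (Suc j)) * \<theta>) + cos (real j * \<theta>) = 2 * cos \<theta> * cos (real (Suc j) * \<theta>)" for j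
  proof -
    have "real (Suc (Suc j)) * \<theta> = real (Suc j) * \<theta> + \<theta>" "real j * \<theta> = real (Suc j) * \<theta> - \<theta>"
      by (simp_all add: algebra_simps)
    then show ?thesis by (simp only: cos_add cos_diff) (simp add: algebra_simps)
  qed
  have step: "reflection_kernel (Suc r) \<theta> =
      reflection_kernel r \<theta> + (cos (real r * \<theta>) + cos (real (Suc r) * \<theta>))" for r
    by (simp add: reflection_kernel_def)
  have "reflection_kernel (Suc (Suc (Suc s))) \<theta> + reflection_kernel (Suc s) \<theta> =
      (reflection_kernel (Suc (Suc s)) \<theta> + reflection_kernel s \<theta>)
      + (cos (real (Suc (Suc s)) * \<theta>) + cos (real s * \<theta>))
      + (cos (real (Suc (Suc (Suc s))) * \<theta>) + cos (real (Suc s) * \<theta>))"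
    unfolding step[of "Suc (Suc s)"] step[of s] by simp
  also have "\<dots> = 2 * cos \<theta> * reflection_kernel (Suc (Suc s)) \<theta>"
    unfolding Suc.IH shift by (simp only: step[of "Suc s"] distrib_left add.assoc)
  finally show ?case .
qed

lemma survival_integrable:
  "(\<lambda>\<theta>. lazy_walk_char lam m \<theta> * reflection_kernel s \<theta>) integrable_on {0..pi}"
  unfolding lazy_walk_char_def reflection_kernel_def
  by (intro integrable_continuous_real continuous_intros)

lemma survival_absorbed [simp]: "survival lam m 0 = 0"
  by (simp add: survival_def reflection_kernel_def)

text \<open>Cosines of positive frequency integrate to 0 over \<open>{0..pi}\<close>; only the
  constant 1 from \<open>j = 0\<close> remains.\<close>

lemma survival_start: "survival lam 0 (Suc s) = 1"
proof -
  have cos_int: "((\<lambda>\<theta>. cos (real (Suc j) * \<theta>)) has_integral 0) {0..pi}" for j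
  proof -
    have "((\<lambda>\<theta>. sin (real (Suc j) * \<theta>) / real (Suc j)) has_real_derivative cos (real (Suc j) * \<theta>))
        (at \<theta> within {0..pi})" for \<theta>
      by (auto intro!: derivative_eq_intros simp del: of_nat_Suc)
    then have "((\<lambda>\<theta>. cos (real (Suc j) * \<theta>)) has_integral
        (sin (real (Suc j) * pi) / real (Suc j) - sin (real (Suc j) * 0) / real (Suc j))) {0..pi}"
      by (intro fundamental_theorem_of_calculus)
        (auto simp flip: has_real_derivative_iff_has_vector_derivative)
    then show ?thesis by (simp only: sin_npi) simp
  qed
  have "(reflection_kernel (Suc s) has_integral pi) {0..pi}"
  proof (induction s)
    case 0
    have "((\<lambda>\<theta>. 1 + cos (real (Suc 0) * \<theta>)) has_integral (pi + 0)) {0..pi}"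
      using has_integral_const_real[of "1::real" 0 pi] by (intro has_integral_add cos_int) simp
    then show ?case by (simp add: reflection_kernel_def[abs_def])
  next
    case (Suc s)
    have "((\<lambda>\<theta>. reflection_kernel (Suc s) \<theta> + (cos (real (Suc s) * \<theta>) + cos (real (Suc (Suc s)) * \<theta>)))
        has_integral (pi + (0 + 0))) {0..pi}"
      by (intro has_integral_add cos_int Suc)
    then show ?case by (simp add: reflection_kernel_def[abs_def])
  qed
  then show ?thesis
    by (simp add: survival_def lazy_walk_char_def integral_unique)
qed

text \<open>The step with index \<open>Suc m\<close> is taken first; on the Fourier side,
  \<open>reflection_kernel_rec\<close> absorbs its factor.\<close>

lemma survival_rec:
  fixes lam :: "nat \<Rightarrow> real" and m :: nat
  defines "p \<equiv> lam (Suc m) * (1 - lam (Suc m))"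
  shows "survival lam (Suc m) (Suc s) =
    p * survival lam m s + (1 - 2 * p) * survival lam m (Suc s) + p * survival lam m (Suc (Suc s))"
proof -
  let ?f = "\<lambda>s \<theta>. lazy_walk_char lam m \<theta> * reflection_kernel s \<theta>"
  have "lazy_walk_char lam (Suc m) \<theta> * reflection_kernel (Suc s) \<theta> =
      p * ?f s \<theta> + (1 - 2 * p) * ?f (Suc s) \<theta> + p * ?f (Suc (Suc s)) \<theta>" for \<theta>
  proof -
    have "p * ?f s \<theta> + (1 - 2 * p) * ?f (Suc s) \<theta> + p * ?f (Suc (Suc s)) \<theta> =
        lazy_walk_char lam m \<theta> * ((1 - 2 * p) * reflection_kernel (Suc s) \<theta> +
          p * (reflection_kernel (Suc (Suc s)) \<theta> + reflection_kernel s \<theta>))"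
      by (simp add: algebra_simps)
    also have "\<dots> = lazy_walk_char lam m \<theta> * (1 - 2 * p * (1 - cos \<theta>)) * reflection_kernel (Suc s) \<theta>"
      unfolding reflection_kernel_rec by (simp add: algebra_simps)
    also have "lazy_walk_char lam m \<theta> * (1 - 2 * p * (1 - cos \<theta>)) = lazy_walk_char lam (Suc m) \<theta>"
      by (simp add: lazy_walk_char_def p_def)
    finally show ?thesis by simp
  qed
  moreover have "((\<lambda>\<theta>. p * ?f s \<theta> + (1 - 2 * p) * ?f (Suc s) \<theta> + p * ?f (Suc (Suc s)) \<theta>) has_integral
      (p * integral {0..pi} (?f s) + (1 - 2 * p) * integral {0..pi} (?f (Suc s))
        + p * integral {0..pi} (?f (Suc (Suc s))))) {0..pi}"
    by (intro has_integral_add has_integral_mult_right integrable_integral survival_integrable)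
  ultimately show ?thesis
    by (simp add: survival_def integral_unique add_divide_distrib)
qed

lemma integral_exp_minus_square_le:
  assumes "0 \<le> r"
  shows "integral {0..r} (\<lambda>w::real. exp (- w\<^sup>2)) \<le> sqrt pi / 2"
proof -
  have "((\<lambda>x::real. indicator {0..} x *\<^sub>R exp (- x\<^sup>2)) has_integral sqrt pi / 2) UNIV"
    using gaussian_moment_0 has_integral_integral_lborel has_bochner_integral_iff by metis
  then have "((\<lambda>x::real. if x \<in> {0..} then exp (- x\<^sup>2) else 0) has_integral sqrt pi / 2) UNIV"
    by (rule has_integral_eq[rotated]) auto
  then have "((\<lambda>x::real. exp (- x\<^sup>2)) has_integral sqrt pi / 2) {0..}"
    by (simp only: has_integral_restrict_UNIV)
  moreover have "((\<lambda>w::real. exp (- w\<^sup>2)) has_integral integral {0..r} (\<lambda>w. exp (- w\<^sup>2))) {0..r}"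
    by (intro integrable_integral integrable_continuous_real continuous_intros)
  ultimately show ?thesis
    by (intro has_integral_subset_le[where s = "{0..r}" and t = "{0..}"]) auto
qed

lemma survival_le:
  fixes lam :: "nat \<Rightarrow> real" and n :: nat
  defines "z \<equiv> (\<Sum>i=1..n. lam i * (1 - lam i))"
  assumes lam: "\<And>i. 1 \<le> i \<Longrightarrow> 0 \<le> lam i \<and> lam i \<le> 1" and z: "0 < z"
  shows "survival lam n 1 \<le> 1 / sqrt (pi * z)"
proof -
  have char: "lazy_walk_char lam n \<theta> \<le> exp (- (2 * z * (1 - cos \<theta>)))" for \<theta>
  proof -
    have "lazy_walk_char lam n \<theta> \<le> (\<Prod>i=1..n. exp (- 2 * (lam i * (1 - lam i)) * (1 - cos \<theta>)))"
      unfolding lazy_walk_char_def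
    proof (rule prod_mono, intro conjI)
      fix i assume i: "i \<in> {1..n}"
      define p where "p = lam i * (1 - lam i)"
      have "p \<ge> 0" using lam[of i] i by (simp add: p_def)
      \<comment> \<open>From \<open>p \<le> 1/4\<close> every factor is nonnegative, as the
        factorwise bound of the product requires.\<close>
      have "1 - 4 * p = (1 - 2 * lam i)\<^sup>2" by (simp add: p_def power2_eq_square algebra_simps)
      then have "4 * p \<le> 1" by (metis diff_ge_0_iff_ge zero_le_power2)
      have "2 * p * (1 - cos \<theta>) \<le> 2 * p * 2"
        using \<open>p \<ge> 0\<close> cos_ge_minus_one[of \<theta>] by (intro mult_left_mono) auto
      then show "0 \<le> 1 - 2 * (lam i * (1 - lam i)) * (1 - cos \<theta>)"
        using \<open>4 * p \<le> 1\<close> by (simp only: flip: p_def)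
      show "1 - 2 * (lam i * (1 - lam i)) * (1 - cos \<theta>)
          \<le> exp (- 2 * (lam i * (1 - lam i)) * (1 - cos \<theta>))"
        using exp_ge_add_one_self[of "- 2 * (lam i * (1 - lam i)) * (1 - cos \<theta>)"] by simp
    qed
    also have "\<dots> = exp (- (2 * z * (1 - cos \<theta>)))"
      by (simp add: exp_sum z_def sum_distrib_left sum_distrib_right flip: sum_negf)
    finally show ?thesis .
  qed
  \<comment> \<open>The choice \<open>r\<^sup>2 = 4 * z\<close> turns the exponent
    \<open>2 * z * (1 - cos \<theta>)\<close> into \<open>w\<^sup>2\<close> for
    \<open>w = r * sin (\<theta> / 2)\<close>.\<close>
  define r where "r = 2 * sqrt z"
  have r: "r > 0" "r\<^sup>2 = 4 * z" using z by (auto simp: r_def power_mult_distrib)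
  define g where "g \<theta> = r * sin (\<theta> / 2)" for \<theta>
  define G where "G = integral {0..r} (\<lambda>w::real. exp (- w\<^sup>2))"
  have "g ` {0..pi} \<subseteq> {0..r}"
    using r(1) by (auto simp: g_def mult_left_le intro!: mult_nonneg_nonneg sin_ge_zero)
  moreover have "(g has_real_derivative r * cos (\<theta> / 2) / 2) (at \<theta> within {0..pi})" for \<theta>
    unfolding g_def by (auto intro!: derivative_eq_intros)
  moreover have "g 0 \<le> g pi" using r(1) by (simp add: g_def)
  moreover have "continuous_on {0..r} (\<lambda>w. exp (- w\<^sup>2))" by (intro continuous_intros)
  ultimately have "((\<lambda>\<theta>. (r * cos (\<theta> / 2) / 2) *\<^sub>R exp (- (g \<theta>)\<^sup>2)) has_integral
      integral {g 0..g pi} (\<lambda>w. exp (- w\<^sup>2))) {0..pi}"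
    using pi_ge_zero by (intro has_integral_substitution)
  then have majorant: "((\<lambda>\<theta>. 4 / r * ((r * cos (\<theta> / 2) / 2) * exp (- (g \<theta>)\<^sup>2))) has_integral (4 / r * G)) {0..pi}"
    by (intro has_integral_mult_right) (simp add: g_def G_def)
  have integrand: "((\<lambda>\<theta>. lazy_walk_char lam n \<theta> * reflection_kernel 1 \<theta>) has_integral
      integral {0..pi} (\<lambda>\<theta>. lazy_walk_char lam n \<theta> * reflection_kernel 1 \<theta>)) {0..pi}"
    by (intro integrable_integral survival_integrable)
  have le: "lazy_walk_char lam n \<theta> * reflection_kernel 1 \<theta>
      \<le> 4 / r * ((r * cos (\<theta> / 2) / 2) * exp (- (g \<theta>)\<^sup>2))" if "\<theta> \<in> {0..pi}" for \<theta>
  proof -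
    have "cos \<theta> = 1 - 2 * (sin (\<theta> / 2))\<^sup>2" "cos \<theta> = 2 * (cos (\<theta> / 2))\<^sup>2 - 1"
      using cos_double_sin[of "\<theta> / 2"] cos_double_cos[of "\<theta> / 2"] by auto
    then have half: "1 - cos \<theta> = 2 * (sin (\<theta> / 2))\<^sup>2" "1 + cos \<theta> = 2 * (cos (\<theta> / 2))\<^sup>2" by auto
    have c0: "0 \<le> cos (\<theta> / 2)" using that by (intro cos_ge_zero) auto
    \<comment> \<open>Weakening the square to \<open>cos (\<theta> / 2)\<close> bounds the kernel by
      \<open>4 / r\<close> times the derivative of \<open>g\<close>.\<close>
    have "(cos (\<theta> / 2))\<^sup>2 \<le> cos (\<theta> / 2)"
      using c0 by (simp add: power2_eq_square mult_left_le)
    then have "1 + cos \<theta> \<le> 2 * cos (\<theta> / 2)" by (simp add: half)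
    moreover have "exp (- (g \<theta>)\<^sup>2) = exp (- (2 * z * (1 - cos \<theta>)))"
      by (simp add: g_def power_mult_distrib r(2) half)
    ultimately have "lazy_walk_char lam n \<theta> * (1 + cos \<theta>) \<le> exp (- (g \<theta>)\<^sup>2) * (2 * cos (\<theta> / 2))"
      using char[of \<theta>] exp_ge_zero[of "- (g \<theta>)\<^sup>2"] cos_ge_minus_one[of \<theta>] by (intro mult_mono) linarith+
    then show ?thesis using r(1) by (simp add: reflection_kernel_def mult_ac)
  qed
  have "integral {0..pi} (\<lambda>\<theta>. lazy_walk_char lam n \<theta> * reflection_kernel 1 \<theta>) \<le> 4 / r * G"
    by (rule has_integral_le[OF integrand majorant le])
  also have "\<dots> \<le> 4 / r * (sqrt pi / 2)"
    using r(1) integral_exp_minus_square_le[of r] unfolding G_def by (intro mult_left_mono) auto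
  also have "\<dots> = sqrt pi / sqrt z" using z by (simp add: r_def)
  finally have "survival lam n 1 \<le> sqrt pi / sqrt z / pi"
    unfolding survival_def by (intro divide_right_mono) auto
  also have "\<dots> = 1 / sqrt (pi * z)"
    using z by (simp add: real_sqrt_mult field_simps)
  finally show ?thesis .
qed

text \<open>The survival probability over \<open>m\<close> steps when the start \<open>s\<close> is raised by an independent sum of
  Bernoulli variables with the parameters \<open>lam (m + 1), \<dots>, lam (m + k)\<close>.\<close>

primrec raised_survival :: "(nat \<Rightarrow> real) \<Rightarrow> nat \<Rightarrow> nat \<Rightarrow> nat \<Rightarrow> real" where
  "raised_survival lam m 0 s = survival lam m s"
| "raised_survival lam m (Suc k) s = (1 - lam (m + Suc k)) * raised_survival lam m k s
     + lam (m + Suc k) * raised_survival lam m k (Suc s)"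

lemma raised_survival_start: "raised_survival lam 0 k (Suc s) = 1"
  by (induction k arbitrary: s) (simp_all add: survival_start)

text \<open>A step of the lazy walk is the difference of two independent Bernoulli variables with
  parameter \<open>lam (Suc m)\<close>: one joins the raise, the other lowers the start. The
  remaining raises are averaged outside this identity.\<close>

lemma raised_survival_Suc:
  "raised_survival lam (Suc m) k (Suc s) =
     (1 - lam (Suc m)) * raised_survival lam m (Suc k) (Suc s)
     + lam (Suc m) * raised_survival lam m (Suc k) s"
proof (induction k arbitrary: s)
  case 0
  show ?case by (simp add: survival_rec algebra_simps)
next
  case (Suc k)
  show ?case
    by (simp only: raised_survival.simps(2)[of lam "Suc m"] Suc
        raised_survival.simps(2)[of lam m "Suc k"]) (simp add: algebra_simps)
qed

section \<open>The rate of asymptotic regularity\<close>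

theorem theorem4p1:
  fixes X K :: "'a::metric_space set"
    and T :: "'a \<Rightarrow> 'a"
    and lam :: "nat \<Rightarrow> real"
    and x :: "nat \<Rightarrow> 'a"
  assumes "complete X" and "CAT0_space X"
    and "K \<noteq> {}" and "closedin (top_of_set X) K" and "geodesic_convex X K" and "bounded K"
    and "T \<in> K \<rightarrow> K"
    and "\<forall>u\<in>K. \<forall>v\<in>K. dist (T u) (T v) \<le> dist u v"
    and "\<forall>n\<ge>1. 0 < lam n \<and> lam n < 1"
    and "x 0 \<in> K"
    and "\<forall>n. x (Suc n) = geodesic_comb X (lam (Suc n)) (x n) (T (x n))"
  shows "\<forall>n\<ge>1. dist (x n) (T (x n)) \<le>
           diameter K / sqrt (pi * (\<Sum>i=1..n. lam i * (1 - lam i)))"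
proof -
  define D where "D = diameter K"
  have lam: "0 \<le> lam (Suc n)" "lam (Suc n) \<le> 1" for n
    using assms(9) by (auto simp: less_imp_le)
  have KX: "K \<subseteq> X" using assms(5) by (simp add: geodesic_convex_def)
  have T: "T u \<in> K" if "u \<in> K" for u using assms(7) that by auto
  have x: "x n \<in> K" for n
  proof (induction n)
    case (Suc n)
    then show ?case
      using geodesic_comb_in_convex[OF assms(2,5) Suc T[OF Suc] lam] assms(11) by simp
  qed (rule assms(10))
  have conv: "dist p (x (Suc n)) \<le> (1 - lam (Suc n)) * dist p (x n) + lam (Suc n) * dist p (T (x n))"
    if "p \<in> K" for p n
    using CAT0_dist_geodesic_comb_le[OF assms(2) _ _ _ lam] that x T KX assms(11)
    by (metis subsetD)
  have step: "dist p (x (Suc n)) \<le> D * ((1 - lam (Suc n)) * a + lam (Suc n) * b)"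
    if "p \<in> K" "dist p (x n) \<le> D * a" "dist p (T (x n)) \<le> D * b" for p n a b
  proof -
    have "(1 - lam (Suc n)) * dist p (x n) + lam (Suc n) * dist p (T (x n))
        \<le> (1 - lam (Suc n)) * (D * a) + lam (Suc n) * (D * b)"
      using that lam[of n] by (intro add_mono mult_left_mono) auto
    then show ?thesis using conv[OF that(1), of n] by (simp add: algebra_simps)
  qed
  have image: "dist (T (x i)) (T (x j)) \<le> dist (x i) (x j)" for i j
    using assms(8) x by blast
  \<comment> \<open>Start 0 belongs to the distance between two iterates, start 1 to the distance
    from an iterate to an image. The claim for \<open>m + 1\<close> and \<open>k\<close> uses
    \<open>m\<close> and \<open>k + 1\<close>, hence the arbitrary \<open>k\<close>.\<close>
  have main: "dist (x m) (x (m + k)) \<le> D * raised_survival lam m k 0 \<and>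
      dist (x m) (T (x (m + k))) \<le> D * raised_survival lam m k 1" for m k
  proof (induction m arbitrary: k)
    case 0
    \<comment> \<open>No step is left to survive, so the bound is just the diameter.\<close>
    have fox: "dist (x 0) (T (x k)) \<le> D * raised_survival lam 0 k 1" for k
      using diameter_bounded_bound[OF assms(6) x T[OF x]] raised_survival_start[of lam k 0]
      by (simp add: D_def)
    \<comment> \<open>Passing from \<open>x k\<close> to \<open>x (Suc k)\<close> mixes in
      \<open>T (x k)\<close> with weight \<open>lam (Suc k)\<close>: the defining recursion of
      \<open>raised_survival\<close>.\<close>
    have "dist (x 0) (x k) \<le> D * raised_survival lam 0 k 0" for k
    proof (induction k)
      case (Suc k)
      then show ?case using step[OF x Suc fox] by simp
    qed simp
    with fox show ?case by simp
  next
    case (Suc m)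
    \<comment> \<open>Now the other end moves, from \<open>x m\<close> towards
      \<open>T (x m)\<close>. Nonexpansiveness strips \<open>T\<close> from both points of the new
      term, so its start drops from 1 to 0.\<close>
    have fox: "dist (x (Suc m)) (T (x (Suc m + k))) \<le> D * raised_survival lam (Suc m) k 1" for k
    proof -
      have "dist (T (x (Suc m + k))) (x m) \<le> D * raised_survival lam m (Suc k) 1"
        using Suc.IH[of "Suc k"] by (simp add: dist_commute)
      moreover have "dist (T (x (Suc m + k))) (T (x m)) \<le> D * raised_survival lam m (Suc k) 0"
        using image[of "m + Suc k" m] Suc.IH[of "Suc k"] by (simp add: dist_commute)
      ultimately have "dist (T (x (Suc m + k))) (x (Suc m)) \<le> D * raised_survival lam (Suc m) k (Suc 0)"
        unfolding raised_survival_Suc using step[OF T[OF x]] by (metis One_nat_def)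
      then show ?thesis by (simp add: dist_commute)
    qed
    have "dist (x (Suc m)) (x (Suc m + k)) \<le> D * raised_survival lam (Suc m) k 0" for k
    proof (induction k)
      case (Suc k)
      then show ?case using step[OF x Suc fox] by simp
    qed simp
    with fox show ?case by blast
  qed
  show ?thesis
  proof (intro allI impI)
    fix n :: nat assume n: "1 \<le> n"
    let ?z = "\<Sum>i=1..n. lam i * (1 - lam i)"
    have "0 < ?z" using n assms(9) by (intro sum_pos) auto
    then have "survival lam n 1 \<le> 1 / sqrt (pi * ?z)"
      using assms(9) by (intro survival_le) (auto simp: less_imp_le)
    moreover have "0 \<le> D" using diameter_ge_0[OF assms(6)] by (simp add: D_def)
    ultimately have "D * survival lam n 1 \<le> D * (1 / sqrt (pi * ?z))" by (rule mult_left_mono)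
    moreover have "dist (x n) (T (x n)) \<le> D * survival lam n 1" using main[of n 0] by simp
    ultimately show "dist (x n) (T (x n)) \<le> diameter K / sqrt (pi * ?z)"
      by (simp add: D_def)
  qed
qed

end
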